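(* For every integer $M \ge 2$, the multi-mode pricing problem without resource constraints and with $|\mathcal{M}| = M$ modes does not possess the integrality property. That is, there exists an instance (project indices and activity set $\mathcal{V}_n$, precedence set $\mathcal{E}_n$, mode set $\mathcal{M}$ with $|\mathcal{M}| = M$, mode subsets $\mathcal{M}_{ij}$, durations $d_{ijm}$, and time horizon $T$) such that $$\operatorname{conv}(X_n) \neq \overline{X}_n ,$$ where $X_n$ is the set of feasible (binary) solutions of the pricing problem and $\overline{X}_n$ is the feasible set of its linear relaxation.
   Context: Setting. Time is discrete, $\mathcal{T} = \{1,\dots,T\}$. Activities are pairs $(i,j)$, where $i$ is a project and $j$ is an activity of project $i$; $\mathcal{V}_n$ is a finite set of activities. $\mathcal{E}_n$ is a set of triples $(i,j,j')$ with $(i,j),(i,j') \in \mathcal{V}_n$, meaning that activity $j'$ of project $i$ may start only after activity $j$ of project $i$ is finished; these relations form an acyclic directed graph. $\mathcal{M} = \{1,\dots,M\}$ is the set of modes, and each activity $(i,j)$ has a nonempty set $\mathcal{M}_{ij} \subseteq \mathcal{M}$ of admissible modes and a positive integer duration $d_{ijm}$ in mode $m \in \mathcal{M}_{ij}$. The variable $x_{ijmt}$ equals $1$ if activity $(i,j)$ is started in mode $m$ in period $t$, and $0$ otherwise. All sums over time indices are restricted to indices in $\mathcal{T}$. Pricing problem without resource constraints. Minimize a linear (affine) objective in $x$ (the reduced cost of a schedule) over the set $X_n$ of all $x$ satisfying $$\sum_{m \in \mathcal{M}_{ij}} \sum_{t \in \mathcal{T}} x_{ijmt} = 1 \quad \forall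 (i,j) \in \mathcal{V}_n,$$ $$\sum_{m \in \mathcal{M}_{ij}} \sum_{s = t-d_{ijm}+1}^{T} x_{ijms} + \sum_{m \in \mathcal{M}_{ij'}} \sum_{s=1}^{t} x_{ij'ms} \le 1 \quad \forall (i,j,j') \in \mathcal{E}_n,\ t \in \mathcal{T},$$ $$x_{ijmt} \in \{0,1\} \quad \forall (i,j) \in \mathcal{V}_n,\ m \in \mathcal{M}_{ij},\ t \in \mathcal{T}.$$ The set $\overline{X}_n$ is defined by the same constraints with $x_{ijmt} \in \{0,1\}$ replaced by $x_{ijmt} \in [0,1]$. Integrality property. An integer program has the integrality property if and only if the convex hull of its set of feasible integer points equals the feasible set of its linear relaxation. A class of integer programs does not possess the integrality property if some instance of the class does not have it. *)

theory Defs
  imports "HOL-Analysis.Analysis" "HOL-Analysis.Finite_Function_Topology"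
begin

text \<open>Activities are pairs (project, activity within the project). In a precedence (i, j, j'),
  both activities belong to project i, and j' may start only after j is finished.\<close>

record pricing_problem =
  activities :: "(nat \<times> nat) set"
  precedences :: "(nat \<times> nat \<times> nat) set"
  num_modes :: nat
  admissible :: "nat \<Rightarrow> nat \<Rightarrow> nat set"
  duration :: "nat \<Rightarrow> nat \<Rightarrow> nat \<Rightarrow> nat"
  horizon :: nat

definition modes :: "pricing_problem \<Rightarrow> nat set" where
  "modes P = {1..num_modes P}"

definition periods :: "pricing_problem \<Rightarrow> nat set" where
  "periods P = {1..horizon P}"

definition valid_pricing_problem :: "pricing_problem \<Rightarrow> bool" where
  "valid_pricing_problem P \<longleftrightarrow>
     finite (activities P) \<and>
     horizon P \<ge> 1 \<and>
     (\<forall>(i, j, j') \<in> precedences P. (i, j) \<in> activities P \<and> (i, j') \<in> activities P) \<and>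
     acyclic {((i, j), (i, j')) | i j j'. (i, j, j') \<in> precedences P} \<and>
     (\<forall>(i, j) \<in> activities P.
        admissible P i j \<noteq> {} \<and> admissible P i j \<subseteq> modes P \<and>
        (\<forall>m \<in> admissible P i j. duration P i j m > 0))"

text \<open>A decision vector has one coordinate (i, j, m, t) for each activity (i, j), admissible
  mode m and period t. As this index set depends on the instance, vectors live in the real vector
  space of finitely supported functions, and \<open>Poly_Mapping.keys x \<subseteq> variables P\<close> cuts out the
  coordinate subspace of the instance.\<close>

type_synonym schedule = "(nat \<times> nat \<times> nat \<times> nat) \<Rightarrow>\<^sub>0 real"

definition variables :: "pricing_problem \<Rightarrow> (nat \<times> nat \<times> nat \<times> nat) set" where
  "variables P =
     {(i, j, m, t). (i, j) \<in> activities P \<and> m \<in> admissible P i j \<and> t \<in> periods P}"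

definition assignment_constraints :: "pricing_problem \<Rightarrow> schedule \<Rightarrow> bool" where
  "assignment_constraints P x \<longleftrightarrow>
     (\<forall>(i, j) \<in> activities P.
        (\<Sum>m \<in> admissible P i j. \<Sum>t \<in> periods P. Poly_Mapping.lookup x (i, j, m, t)) = 1)"

text \<open>The lower summation limit \<open>t - d + 1\<close> may be nonpositive, so it is compared as an integer;
  only the indices that are periods contribute.\<close>

definition precedence_constraints :: "pricing_problem \<Rightarrow> schedule \<Rightarrow> bool" where
  "precedence_constraints P x \<longleftrightarrow>
     (\<forall>(i, j, j') \<in> precedences P. \<forall>t \<in> periods P.
        (\<Sum>m \<in> admissible P i j.
           \<Sum>s \<in> {s \<in> periods P. int s \<ge> int t - int (duration P i j m) + 1}.
             Poly_Mapping.lookup x (i, j, m, s)) +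
        (\<Sum>m \<in> admissible P i j'. \<Sum>s \<in> {s \<in> periods P. s \<le> t}. Poly_Mapping.lookup x (i, j', m, s))
        \<le> 1)"

definition feasible_integer :: "pricing_problem \<Rightarrow> schedule set" where
  "feasible_integer P =
     {x. Poly_Mapping.keys x \<subseteq> variables P \<and> assignment_constraints P x \<and> precedence_constraints P x \<and>
         (\<forall>v \<in> variables P. Poly_Mapping.lookup x v \<in> {0, 1})}"

definition feasible_relaxed :: "pricing_problem \<Rightarrow> schedule set" where
  "feasible_relaxed P =
     {x. Poly_Mapping.keys x \<subseteq> variables P \<and> assignment_constraints P x \<and> precedence_constraints P x \<and>
         (\<forall>v \<in> variables P. Poly_Mapping.lookup x v \<in> {0..1})}"

text \<open>The objective plays no role in the integrality property and is not part of an instance.\<close>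

definition integrality_property :: "pricing_problem \<Rightarrow> bool" where
  "integrality_property P \<longleftrightarrow> convex hull (feasible_integer P) = feasible_relaxed P"

end

theory Submission
  imports Defs
begin

text \<open>The counterexample is a diamond of precedences in one project: activity 1 precedes
  activities 2 and 3, and both of these precede activity 4.

  A relaxed solution gives each activity a probability distribution over (mode, start) pairs,
  and the constraint of a precedence says that the finish of the predecessor is stochastically
  earlier than the start of the successor. Along a single precedence such distributions can be
  coupled so that the precedence holds with certainty, and couplings can be glued together along a
  tree of precedences; a fractional point outside the hull needs an undirected cycle on which
  the couplings are incompatible. Two modes make this possible, because an activity in a long
  mode can start earlier and finish later than the same activity in a short mode.

  Let activity 2 have duration 3 in mode 1 and duration 1 in mode 2, let activity 3 have duration
  2, and let the horizon be 5. In the fractional point, activities 1, 3 and 4 each start with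
  weight 1/2 at an early and with weight 1/2 at a late period (1 or 2, 2 or 3, 4 or 5), whereas
  activity 2 starts with weight 1/2 at period 2 in its long mode (finishing in period 4) and with
  weight 1/2 at period 3 in its short mode (finishing in period 3). The branch through activity 3
  couples an early activity 1 with an early activity 4. The branch through activity 2 reverses the
  order, and couples an early activity 1 with a late activity 4.

  This conflict is made precise by a cut that every schedule satisfies
  (\<open>diamond_cut_valid\<close>) and the fractional point, although feasible for the relaxation
  (\<open>half_schedule_feasible\<close>), violates (\<open>half_schedule_violates_cut\<close>). A linear inequality that
  holds on a set holds on its convex hull.\<close>

definition diamond :: "nat \<Rightarrow> pricing_problem" where
  "diamond M =
     \<lparr>activities = {(1, 1), (1, 2), (1, 3), (1, 4)},
      precedences = {(1, 1, 2), (1, 1, 3), (1, 2, 4), (1, 3, 4)},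
      num_modes = M,
      admissible = (\<lambda>i j. if j = 2 then {1, 2} else {1}),
      duration = (\<lambda>i j m. if j = 2 \<and> m = 1 then 3 else if j = 3 then 2 else 1),
      horizon = 5\<rparr>"

lemma periods_diamond: "periods (diamond M) = {1, 2, 3, 4, 5}"
  by (auto simp: periods_def diamond_def)

lemma sum_periods_diamond:
  "(\<Sum>s\<in>{s \<in> periods (diamond M). Q s}. f s) = (\<Sum>s\<in>{1, 2, 3, 4, 5}. if Q s then f s else 0)"
  by (simp add: periods_diamond sum.inter_filter del: sum.insert insert_iff)

lemma valid_diamond:
  assumes "M \<ge> 2"
  shows "valid_pricing_problem (diamond M)"
proof -
  let ?E = "{((i, j), (i, j')) | i j j'. (i, j, j') \<in> precedences (diamond M)}"
  \<comment> \<open>Every precedence goes from a smaller to a larger activity number.\<close>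
  have "?E \<subseteq> inv_image less_than snd"
    by (auto simp: diamond_def)
  then have "acyclic ?E"
    by (meson wf_subset wf_acyclic wf_inv_image wf_less_than)
  then show ?thesis
    using assms unfolding valid_pricing_problem_def
    by (auto simp: diamond_def modes_def)
qed

text \<open>If activity 1 starts at period 2, the horizon is too short for activity 2 in its long
  mode followed by activity 4. If activity 4 starts at period 4, it is too early to have activity 1
  and the long mode of activity 2 before it. If both happen, there is no room for activity 3.
  The cut sums this up: the two events exclude each other, and each of them forces activity 2 into
  its short mode.\<close>

definition diamond_cut :: "schedule \<Rightarrow> bool" where
  "diamond_cut x \<longleftrightarrow>
     Poly_Mapping.lookup x (1, 1, 1, 2) + Poly_Mapping.lookup x (1, 4, 1, 4)
       \<le> (\<Sum>t\<in>{1, 2, 3, 4, 5}. Poly_Mapping.lookup x (1, 2, 2, t))"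

lemma lookup_scaleR: "Poly_Mapping.lookup (c *\<^sub>R x) v = c * Poly_Mapping.lookup x v"
proof -
  have "finite {i. c * Poly_Mapping.lookup x i \<noteq> 0}"
    by (rule finite_subset[OF _ finite_keys[of x]]) (auto simp: in_keys_iff)
  then show ?thesis
    by (simp add: scaleR_poly_mapping_def)
qed

lemma convex_diamond_cut: "convex (Collect diamond_cut)"
proof (rule convexI)
  fix x y :: schedule and u v :: real
  assume xy: "x \<in> Collect diamond_cut" "y \<in> Collect diamond_cut" and uv: "0 \<le> u" "0 \<le> v"
  have "u * (Poly_Mapping.lookup x (1, 1, 1, 2) + Poly_Mapping.lookup x (1, 4, 1, 4))
          \<le> u * (\<Sum>t\<in>{1, 2, 3, 4, 5}. Poly_Mapping.lookup x (1, 2, 2, t))"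
    and "v * (Poly_Mapping.lookup y (1, 1, 1, 2) + Poly_Mapping.lookup y (1, 4, 1, 4))
          \<le> v * (\<Sum>t\<in>{1, 2, 3, 4, 5}. Poly_Mapping.lookup y (1, 2, 2, t))"
    using xy uv by (auto simp: diamond_cut_def intro!: mult_left_mono)
  then show "u *\<^sub>R x + v *\<^sub>R y \<in> Collect diamond_cut"
    by (simp add: diamond_cut_def lookup_add lookup_scaleR algebra_simps)
qed

lemma diamond_cut_valid:
  assumes "x \<in> feasible_integer (diamond M)"
  shows "diamond_cut x"
proof -
  define a where "a j m t = Poly_Mapping.lookup x (1, j, m, t)" for j m t :: nat
  have assign: "assignment_constraints (diamond M) x"
    and prec: "precedence_constraints (diamond M) x"
    and int: "v \<in> variables (diamond M) \<Longrightarrow> Poly_Mapping.lookup x v \<in> {0, 1}" for v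
    using assms by (auto simp: feasible_integer_def)
  have nonneg: "\<forall>t\<in>{1, 2, 3, 4, 5}.
      0 \<le> a 1 1 t \<and> 0 \<le> a 2 1 t \<and> 0 \<le> a 2 2 t \<and> 0 \<le> a 3 1 t \<and> 0 \<le> a 4 1 t"
  proof -
    have "0 \<le> Poly_Mapping.lookup x v" if "v \<in> variables (diamond M)" for v
      using int[OF that] by auto
    then show ?thesis
      unfolding a_def variables_def periods_diamond by (simp add: diamond_def)
  qed
  have total: "(\<Sum>t\<in>{1, 2, 3, 4, 5}. a 1 1 t) = 1" "(\<Sum>t\<in>{1, 2, 3, 4, 5}. a 3 1 t) = 1"
    "(\<Sum>t\<in>{1, 2, 3, 4, 5}. a 4 1 t) = 1"
    "(\<Sum>t\<in>{1, 2, 3, 4, 5}. a 2 1 t) + (\<Sum>t\<in>{1, 2, 3, 4, 5}. a 2 2 t) = 1"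
    using assign unfolding assignment_constraints_def periods_diamond a_def
    by (simp_all add: diamond_def)
  have order: "(\<Sum>m\<in>admissible (diamond M) 1 j. \<Sum>s\<in>{1, 2, 3, 4, 5}.
           if int s \<ge> int t - int (duration (diamond M) 1 j m) + 1 then a j m s else 0) +
        (\<Sum>m\<in>admissible (diamond M) 1 j'. \<Sum>s\<in>{1, 2, 3, 4, 5}.
           if s \<le> t then a j' m s else 0) \<le> 1"
    if "(1, j, j') \<in> precedences (diamond M)" "t \<in> {1, 2, 3, 4, 5}" for j j' t
    using prec that
    unfolding precedence_constraints_def sum_periods_diamond a_def
    unfolding periods_diamond by blast
  have "a 1 1 2 \<in> {0, 1}" "a 4 1 4 \<in> {0, 1}"
    unfolding a_def
    by (rule int; auto simp: variables_def periods_diamond; simp add: diamond_def)+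
  moreover have "a 1 1 2 + a 4 1 4 \<le> (\<Sum>t\<in>{1, 2, 3, 4, 5}. a 2 2 t)"
    if "a 1 1 2 = 0" "a 4 1 4 = 0"
    using that nonneg by simp
  \<comment> \<open>Activity 3 starts at period 3 or later and still runs in period 4.\<close>
  moreover have False if "a 1 1 2 = 1" "a 4 1 4 = 1"
    using order[of 1 3 2] order[of 3 4 4] total nonneg that
    by (simp add: diamond_def)
  \<comment> \<open>Activity 2 starts at period 3 or later, and its long mode would run through the last period.\<close>
  moreover have "(\<Sum>t\<in>{1, 2, 3, 4, 5}. a 2 2 t) \<ge> 1" if "a 1 1 2 = 1"
    using order[of 1 2 2] order[of 2 4 5] total nonneg that
    by (simp add: diamond_def)
  \<comment> \<open>Activity 2 starts at period 2 or later, and its long mode would still run in period 4.\<close>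
  moreover have "(\<Sum>t\<in>{1, 2, 3, 4, 5}. a 2 2 t) \<ge> 1" if "a 4 1 4 = 1"
    using order[of 1 2 1] order[of 2 4 4] total nonneg that
    by (simp add: diamond_def)
  ultimately show ?thesis
    unfolding diamond_cut_def a_def[symmetric] by fastforce
qed

definition half_support :: "(nat \<times> nat \<times> nat \<times> nat) set" where
  "half_support =
     {(1, 1, 1, 1), (1, 1, 1, 2), (1, 2, 1, 2), (1, 2, 2, 3),
      (1, 3, 1, 2), (1, 3, 1, 3), (1, 4, 1, 4), (1, 4, 1, 5)}"

definition half_schedule :: schedule where
  "half_schedule = (\<Sum>v\<in>half_support. Poly_Mapping.single v (1/2))"

lemma lookup_half_schedule:
  "Poly_Mapping.lookup half_schedule v = (if v \<in> half_support then 1/2 else 0)"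
proof -
  have "finite half_support"
    by (simp add: half_support_def)
  then show ?thesis
    by (simp add: half_schedule_def lookup_sum lookup_single when_def sum.delta)
qed

lemma half_schedule_feasible: "half_schedule \<in> feasible_relaxed (diamond M)"
proof -
  have "Poly_Mapping.keys half_schedule \<subseteq> half_support"
    by (auto simp: in_keys_iff lookup_half_schedule split: if_splits)
  also have "half_support \<subseteq> variables (diamond M)"
    unfolding variables_def periods_diamond
    by (simp add: half_support_def diamond_def)
  finally have "Poly_Mapping.keys half_schedule \<subseteq> variables (diamond M)" .
  moreover have "assignment_constraints (diamond M) half_schedule"
    unfolding assignment_constraints_def periods_diamond lookup_half_schedule
    by (simp add: diamond_def half_support_def)
  moreover have "precedence_constraints (diamond M) half_schedule"
    unfolding precedence_constraints_def sum_periods_diamond lookup_half_schedule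
    unfolding periods_diamond by (simp add: diamond_def half_support_def)
  ultimately show ?thesis
    by (simp add: feasible_relaxed_def lookup_half_schedule)
qed

lemma half_schedule_violates_cut: "\<not> diamond_cut half_schedule"
  unfolding diamond_cut_def lookup_half_schedule by (simp add: half_support_def)

theorem proposition3:
  fixes M :: nat
  assumes "M \<ge> 2"
  shows "\<exists>P. valid_pricing_problem P \<and> card (modes P) = M \<and> \<not> integrality_property P"
proof (intro exI conjI)
  show "valid_pricing_problem (diamond M)"
    using assms by (rule valid_diamond)
  show "card (modes (diamond M)) = M"
    by (simp add: modes_def diamond_def)
  have "convex hull feasible_integer (diamond M) \<subseteq> Collect diamond_cut"
    by (rule hull_minimal) (auto simp: diamond_cut_valid convex_diamond_cut)
  then show "\<not> integrality_property (diamond M)"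
    using half_schedule_feasible half_schedule_violates_cut
    unfolding integrality_property_def by blast
qed

end
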